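(* Let $X=\{x,y,z\}$ and $U=\{u,v,w\}$ be three-element subsets of $\Sigma^+$ such that $X^*$ and $U^*$ are distinct $3$-maximal submonoids of $\Sigma^*$. Then either $X^*\cap U^*=\{\alpha,\beta\}^*$ for some $\alpha,\beta\in\Sigma^*$, or $X^*\cap U^*=(\alpha\gamma^*\beta)^*=\{\alpha\gamma^i\beta : i\ge 0\}^*$ for some $\alpha,\beta,\gamma\in\Sigma^+$.
   Context: $\Sigma$ is a countable alphabet, $\Sigma^*$ the free monoid of finite words over $\Sigma$, $\Sigma^+=\Sigma^*\setminus\{\epsilon\}$, and $Y^*$ denotes the submonoid generated by $Y\subseteq\Sigma^*$. The basis of a submonoid $M$ is $(M\setminus\{\epsilon\})\setminus(M\setminus\{\epsilon\})^2$ and the rank of $M$ is the cardinality of its basis. A submonoid $M$ of rank at most $k$ is $k$-maximal if for every submonoid $M'$ of $\Sigma^*$ of rank at most $k$, $M\subseteq M'$ implies $M=M'$. *)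

theory Defs
  imports Main "HOL-Library.Countable" "HOL-Library.Extended_Nat"
begin

inductive_set gen_monoid :: "'a list set \<Rightarrow> 'a list set" for Y :: "'a list set" where
  gen_nil: "[] \<in> gen_monoid Y"
| gen_app: "y \<in> Y \<Longrightarrow> w \<in> gen_monoid Y \<Longrightarrow> y @ w \<in> gen_monoid Y"

definition submonoid :: "'a list set \<Rightarrow> bool" where
  "submonoid M \<longleftrightarrow> [] \<in> M \<and> (\<forall>u\<in>M. \<forall>v\<in>M. u @ v \<in> M)"

definition word_prod :: "'a list set \<Rightarrow> 'a list set \<Rightarrow> 'a list set" where
  "word_prod A B = {u @ v | u v. u \<in> A \<and> v \<in> B}"

definition basis :: "'a list set \<Rightarrow> 'a list set" where
  "basis M = (M - {[]}) - word_prod (M - {[]}) (M - {[]})"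

definition rank :: "'a list set \<Rightarrow> enat" where
  "rank M = (if finite (basis M) then enat (card (basis M)) else \<infinity>)"

definition k_maximal :: "nat \<Rightarrow> 'a list set \<Rightarrow> bool" where
  "k_maximal k M \<longleftrightarrow> submonoid M \<and> rank M \<le> enat k \<and>
     (\<forall>M'. submonoid M' \<and> rank M' \<le> enat k \<and> M \<subseteq> M' \<longrightarrow> M = M')"

definition word_pow :: "'a list \<Rightarrow> nat \<Rightarrow> 'a list" where
  "word_pow w i = concat (replicate i w)"

end

theory Submission
  imports Defs "HOL-Library.Sublist"
begin

text \<open>The bases of both monoids are prefix codes: a basis element \<open>x = y @ t\<close> could be replaced by
  \<open>t\<close>, contradicting maximality. Let \<open>Y\<close> be the basis of the smallest submonoid containing both
  monoids that is closed under cancelling a right factor. Its words can be used as letters, and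
  each of them is the first letter of a basis word, for otherwise the elements not starting with
  it would form a smaller such submonoid. By maximality, \<open>Y\<close> has at least four elements, so at
  least four letters start a basis word. Unless the intersection is trivial, one of
  the two bases, say \<open>X\<close>, then has three words with distinct first letters. In the product of the
  two prefix trees only the root of the tree of \<open>X\<close> can take part in a branching, and counting
  first letters leaves a single node of the tree of \<open>U\<close> and two letters for it. An automaton with
  one binary branching state accepts either two first-return words or a language
  \<open>\<alpha>\<gamma>\<^sup>*\<beta>\<close>.\<close>

section \<open>Generated submonoids\<close>

lemma gen_base: "y \<in> Y \<Longrightarrow> y \<in> gen_monoid Y"
  using gen_app[OF _ gen_nil, of y Y] by simp

lemma gen_append:
  assumes "u \<in> gen_monoid Y" and "v \<in> gen_monoid Y"
  shows "u @ v \<in> gen_monoid Y"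
  using assms by induction (auto intro: gen_app)

lemma submonoid_gen: "submonoid (gen_monoid Y)"
  by (simp add: submonoid_def gen_nil gen_append)

lemma gen_least:
  assumes "submonoid M" and "Y \<subseteq> M"
  shows "gen_monoid Y \<subseteq> M"
proof
  fix w assume "w \<in> gen_monoid Y"
  then show "w \<in> M"
    by induction (use assms in \<open>auto simp: submonoid_def\<close>)
qed

text \<open>\<open>concat\<close> is the morphism that spells out a word whose letters are
  themselves words. This equality carries results over such an alphabet back to the original
  one.\<close>

lemma gen_image_concat: "gen_monoid (concat ` Z) = concat ` gen_monoid Z"
proof
  show "gen_monoid (concat ` Z) \<subseteq> concat ` gen_monoid Z"
  proof
    fix w assume "w \<in> gen_monoid (concat ` Z)"
    then show "w \<in> concat ` gen_monoid Z"
    proof induction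
      case gen_nil
      show ?case by (rule image_eqI[of _ _ "[]"]) (simp_all add: gen_monoid.gen_nil)
    next
      case (gen_app y w)
      then obtain z v where "z \<in> Z" "y = concat z" "v \<in> gen_monoid Z" "w = concat v" by blast
      then show ?case
        by (intro image_eqI[of _ _ "z @ v"]) (simp_all add: gen_monoid.gen_app)
    qed
  qed
  show "concat ` gen_monoid Z \<subseteq> gen_monoid (concat ` Z)"
  proof
    fix w assume "w \<in> concat ` gen_monoid Z"
    then obtain v where "v \<in> gen_monoid Z" and w: "w = concat v" by blast
    from this(1) have "concat v \<in> gen_monoid (concat ` Z)"
      by induction (auto intro: gen_nil gen_app)
    then show "w \<in> gen_monoid (concat ` Z)" using w by simp
  qed
qed

lemma gen_eq_concat_lists: "gen_monoid Y = concat ` lists Y"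
proof
  show "gen_monoid Y \<subseteq> concat ` lists Y"
  proof
    fix w assume "w \<in> gen_monoid Y"
    then show "w \<in> concat ` lists Y"
    proof induction
      case gen_nil
      show ?case by (rule image_eqI[of _ _ "[]"]) simp_all
    next
      case (gen_app y w)
      then obtain ws where "ws \<in> lists Y" "w = concat ws" by blast
      with gen_app show ?case by (intro image_eqI[of _ _ "y # ws"]) simp_all
    qed
  qed
  have "concat ws \<in> gen_monoid Y" if "ws \<in> lists Y" for ws
    using that by (induction ws) (auto intro: gen_nil gen_app)
  then show "concat ` lists Y \<subseteq> gen_monoid Y" by blast
qed

lemma basis_gen_subset: "basis (gen_monoid F) \<subseteq> F"
proof
  fix w assume w: "w \<in> basis (gen_monoid F)"
  then have "w \<in> gen_monoid F" by (simp add: basis_def)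
  then show "w \<in> F" using w
  proof induction
    case gen_nil
    then show ?case by (simp add: basis_def)
  next
    case (gen_app y w)
    show ?case
    proof (cases "y = [] \<or> w = []")
      case True
      then show ?thesis using gen_app by auto
    next
      case False
      then have "y @ w \<in> word_prod (gen_monoid F - {[]}) (gen_monoid F - {[]})"
        using gen_app.hyps gen_base[of y F] by (auto simp: word_prod_def)
      then show ?thesis using gen_app.prems by (simp add: basis_def)
    qed
  qed
qed

lemma rank_gen_le:
  assumes "finite F" and "card F \<le> k"
  shows "rank (gen_monoid F) \<le> enat k"
proof -
  have "finite (basis (gen_monoid F))" "card (basis (gen_monoid F)) \<le> card F"
    using assms(1) basis_gen_subset[of F] by (auto intro: finite_subset card_mono)
  then show ?thesis using assms(2) by (simp add: rank_def)
qed

lemma gen_basis: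
  assumes "submonoid M"
  shows "gen_monoid (basis M) = M"
proof
  show "gen_monoid (basis M) \<subseteq> M"
    using assms by (intro gen_least) (auto simp: basis_def)
  show "M \<subseteq> gen_monoid (basis M)"
  proof
    fix w assume "w \<in> M"
    then show "w \<in> gen_monoid (basis M)"
    proof (induction w rule: length_induct)
      case (1 w)
      consider "w = []" | "w \<in> basis M" | "w \<in> word_prod (M - {[]}) (M - {[]})"
        using 1(2) by (auto simp: basis_def)
      then show ?case
      proof cases
        case 3
        then obtain u v where "w = u @ v" "u \<in> M" "v \<in> M" "u \<noteq> []" "v \<noteq> []"
          by (auto simp: word_prod_def)
        then show ?thesis using 1(1) by (auto intro: gen_append)
      qed (auto intro: gen_nil gen_base)
    qed
  qed
qed

section \<open>Prefix codes\<close>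

definition prefix_code :: "'a list set \<Rightarrow> bool" where
  "prefix_code X \<longleftrightarrow> [] \<notin> X \<and> (\<forall>x\<in>X. \<forall>y\<in>X. prefix x y \<longrightarrow> x = y)"

lemma gen_cases:
  assumes "w \<in> gen_monoid X" and "w \<noteq> []"
  obtains x v where "x \<in> X" "v \<in> gen_monoid X" "w = x @ v"
  using assms by (cases rule: gen_monoid.cases) auto

text \<open>The first factors of two factorizations are prefixes of one word, hence comparable,
  hence equal in a prefix code; they can be stripped one by one.\<close>

lemma prefix_code_cancel:
  assumes "prefix_code X" and "u \<in> gen_monoid X"
  shows "u @ v \<in> gen_monoid X \<longleftrightarrow> v \<in> gen_monoid X"
proof
  from assms(2) show "v \<in> gen_monoid X" if "u @ v \<in> gen_monoid X"
    using that
  proof induction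
    case (gen_app y w)
    have "y \<noteq> []" using gen_app(1) assms(1) by (auto simp: prefix_code_def)
    then obtain x t where xt: "x \<in> X" "t \<in> gen_monoid X" "(y @ w) @ v = x @ t"
      using gen_cases[OF gen_app.prems] by (metis append_is_Nil_conv)
    then have "prefix x y \<or> prefix y x"
      by (metis append.assoc prefixI prefix_same_cases)
    then have "x = y" using assms(1) gen_app(1) xt(1) by (auto simp: prefix_code_def)
    then show ?case using xt gen_app.IH by simp
  qed simp
qed (rule gen_append[OF assms(2)])

text \<open>Strip code words from \<open>p\<close> as long as one is a prefix of it. What remains is
  a node \<open>q\<close> of the prefix tree of \<open>X\<close> at which two code words part, so
  branching in the monoid comes from branching in that tree.\<close>

lemma gen_branch:
  assumes X: "prefix_code X"
    and "p @ c # s \<in> gen_monoid X" and "p @ d # t \<in> gen_monoid X"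
  shows "\<exists>u q x y. p = u @ q \<and> u \<in> gen_monoid X \<and> x \<in> X \<and> y \<in> X \<and>
    prefix (q @ [c]) x \<and> prefix (q @ [d]) y"
  using assms(2,3)
proof (induction p rule: length_induct)
  case (1 p)
  obtain x s' where x: "x \<in> X" "p @ c # s = x @ s'"
    using gen_cases[OF 1(2)] by blast
  obtain y t' where y: "y \<in> X" "p @ d # t = y @ t'"
    using gen_cases[OF 1(3)] by blast
  show ?case
  proof (cases "\<exists>z\<in>X. prefix z p")
    case True
    then obtain z p' where z: "z \<in> X" "p = z @ p'" by (auto simp: prefix_def)
    have "z \<noteq> []" using z X by (auto simp: prefix_code_def)
    then have "length p' < length p" using z by simp
    moreover have "p' @ c # s \<in> gen_monoid X" "p' @ d # t \<in> gen_monoid X"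
      using 1(2,3) prefix_code_cancel[OF X gen_base[OF z(1)]] z(2) by simp_all
    ultimately obtain u q x y where "p' = u @ q" "u \<in> gen_monoid X" "x \<in> X" "y \<in> X"
      "prefix (q @ [c]) x" "prefix (q @ [d]) y"
      using 1(1) by blast
    then show ?thesis
      using z by (intro exI[of _ "z @ u"] exI[of _ q] exI[of _ x] exI[of _ y])
        (auto intro: gen_append gen_base)
  next
    case False
    \<comment> \<open>No code word fits inside \<open>p\<close>, so the first factor of either word
      has to reach past the letter at which the words part.\<close>
    have longer: "prefix (p @ [e]) z" if "z \<in> X" "p @ e # r = z @ r'" for e z r r'
    proof -
      have "prefix z (p @ [e] @ r)" "prefix (p @ [e]) (p @ [e] @ r)"
        using that(2) by (simp_all add: prefix_def) (metis that(2))
      then have "prefix z (p @ [e]) \<or> prefix (p @ [e]) z"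
        by (metis prefix_same_cases)
      then show ?thesis using False that(1) by auto
    qed
    show ?thesis
      using longer[OF x] longer[OF y] x(1) y(1)
      by (intro exI[of _ "[]"] exI[of _ p] exI[of _ x] exI[of _ y]) (simp add: gen_nil)
  qed
qed

lemma k_maximal_basis_prefix_code:
  assumes "k_maximal k M"
  shows "prefix_code (basis M)"
  unfolding prefix_code_def
proof (intro conjI ballI impI)
  show "[] \<notin> basis M" by (simp add: basis_def)
  have M: "submonoid M" "rank M \<le> enat k" using assms by (auto simp: k_maximal_def)
  then have fin: "finite (basis M)" "card (basis M) \<le> k"
    by (auto simp: rank_def split: if_splits)
  fix y x assume y: "y \<in> basis M" and x: "x \<in> basis M" and "prefix y x"
  then obtain t where t: "x = y @ t" by (auto simp: prefix_def)
  show "y = x"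
  proof (rule ccontr)
    assume neq: "y \<noteq> x"
    \<comment> \<open>Exchanging \<open>x\<close> for \<open>t\<close> adds no generator, and
      \<open>x = y @ t\<close> is still generated because \<open>y\<close> is kept. Maximality then
      puts \<open>t\<close> into \<open>M\<close>, so \<open>x\<close> is decomposable.\<close>
    define F where "F = insert t (basis M - {x})"
    have "card F \<le> k"
      using fin card_Suc_Diff1[OF fin(1) x] by (simp add: F_def card_insert_if)
    then have "rank (gen_monoid F) \<le> enat k"
      using fin by (intro rank_gen_le) (simp_all add: F_def)
    moreover have yt: "y \<in> gen_monoid F" "t \<in> gen_monoid F"
      using y neq by (auto simp: F_def intro: gen_base)
    then have "basis M \<subseteq> gen_monoid F"
      using t by (auto simp: F_def intro: gen_base gen_append)
    then have "M \<subseteq> gen_monoid F"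
      using gen_least[OF submonoid_gen] gen_basis[OF M(1)] by blast
    ultimately have "gen_monoid F = M"
      using assms submonoid_gen[of F] by (auto simp: k_maximal_def)
    then have "y \<in> M - {[]}" "t \<in> M - {[]}"
      using yt y neq t by (auto simp: basis_def)
    then have "x \<in> word_prod (M - {[]}) (M - {[]})"
      using t by (auto simp: word_prod_def)
    then show False using x by (simp add: basis_def)
  qed
qed

section \<open>The suffix hull\<close>

text \<open>Decoding proceeds from the right: the last factors are suffixes of the same word, hence
  comparable, hence equal.\<close>

lemma suffix_code_inj_concat:
  assumes "[] \<notin> Y" and "\<And>x y. x \<in> Y \<Longrightarrow> y \<in> Y \<Longrightarrow> suffix x y \<Longrightarrow> x = y"
  shows "inj_on concat (lists Y)"
proof (rule inj_onI)
  fix xs ys assume "xs \<in> lists Y" "ys \<in> lists Y" "concat xs = concat ys"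
  then show "xs = ys"
  proof (induction xs arbitrary: ys rule: rev_induct)
    case Nil
    then show ?case using assms(1) by (cases ys) auto
  next
    case (snoc x xs)
    then have "ys \<noteq> []" using assms(1) by auto
    then obtain zs z where ys: "ys = zs @ [z]" by (metis rev_exhaust)
    then have eq: "concat xs @ x = concat zs @ z" using snoc by simp
    have "suffix x (concat zs @ z)" by (rule suffixI[OF eq[symmetric]])
    moreover have "suffix z (concat zs @ z)" by (rule suffixI[OF refl])
    ultimately have "suffix x z \<or> suffix z x" by (rule suffix_same_cases)
    then have "x = z" using assms(2)[of x z] assms(2)[of z x] snoc.prems(1,2) ys by auto
    then show ?case using eq snoc.IH[of zs] snoc.prems(1,2) ys by simp
  qed
qed

text \<open>The required closure properties survive intersections, so a least submonoid exists. Its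
  basis \<open>Y\<close> is a suffix code and can serve as a new alphabet; minimality forces every
  letter to begin some word of \<open>Z\<close>.\<close>

lemma suffix_hull:
  fixes Z :: "'a list set"
  obtains Y where "[] \<notin> Y" "inj_on concat (lists Y)" "Z \<subseteq> concat ` lists Y"
    "\<And>y. y \<in> Y \<Longrightarrow> \<exists>zs \<in> lists Y. concat (y # zs) \<in> Z"
proof -
  define unitary :: "'a list set \<Rightarrow> bool" where
    "unitary N \<longleftrightarrow> submonoid N \<and> (\<forall>u v. v \<in> N \<longrightarrow> u @ v \<in> N \<longrightarrow> u \<in> N)" for N
  define M where "M = \<Inter>{N. unitary N \<and> Z \<subseteq> N}"
  define Y where "Y = basis M"
  have sub: "submonoid M" unfolding M_def unitary_def submonoid_def by blast
  moreover have "u \<in> M" if "v \<in> M" "u @ v \<in> M" for u v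
    using that unfolding M_def unitary_def by blast
  ultimately have M: "unitary M" unfolding unitary_def by blast
  have gen: "gen_monoid Y = M" unfolding Y_def by (rule gen_basis[OF sub])
  have nil: "[] \<notin> Y" by (simp add: Y_def basis_def)
  have inj: "inj_on concat (lists Y)"
  proof (rule suffix_code_inj_concat[OF nil])
    fix x y assume x: "x \<in> Y" and y: "y \<in> Y" and "suffix x y"
    then obtain t where t: "y = t @ x" by (auto simp: suffix_def)
    then have "t \<in> M" using M x y gen gen_base[of _ Y] by (auto simp: unitary_def)
    then have "t = []"
      using x y t by (auto simp: Y_def basis_def word_prod_def)
    then show "x = y" using t by simp
  qed
  have dec: "M = concat ` lists Y" using gen gen_eq_concat_lists by blast
  have first: "\<exists>zs \<in> lists Y. concat (y # zs) \<in> Z" if y: "y \<in> Y" for y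
  proof (rule ccontr)
    assume no: "\<not> ?thesis"
    \<comment> \<open>These are the elements of \<open>M\<close> whose factorization does not start
      with \<open>y\<close>. If no word of \<open>Z\<close> starts with \<open>y\<close>, then
      \<open>N\<close> is a competitor for \<open>M\<close> that misses \<open>y\<close>.\<close>
    define N where "N = {w \<in> M. \<forall>m\<in>M. w \<noteq> y @ m}"
    have yM: "y \<in> M" using y gen gen_base by blast
    have "submonoid N"
      unfolding submonoid_def
    proof (intro conjI ballI)
      show "[] \<in> N" using y nil sub by (auto simp: N_def submonoid_def)
      fix u v assume u: "u \<in> N" and v: "v \<in> N"
      have "False" if m: "m \<in> M" "u @ v = y @ m" for m
      proof -
        obtain us vs ms where d: "us \<in> lists Y" "u = concat us" "vs \<in> lists Y" "v = concat vs"
          "ms \<in> lists Y" "m = concat ms"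
          using u v m dec by (auto simp: N_def)
        then have "concat (us @ vs) = concat (y # ms)" using m by simp
        \<comment> \<open>Unique factorization: the first letter of \<open>u @ v\<close> is that of
          \<open>u\<close>, or that of \<open>v\<close> when \<open>u\<close> is empty.\<close>
        then have eq: "us @ vs = y # ms"
          using inj_onD[OF inj, of "us @ vs" "y # ms"] d y by simp
        show False
        proof (cases us)
          case Nil
          then show False using v m d by (auto simp: N_def)
        next
          case (Cons a us')
          then have "u = y @ concat us'" "concat us' \<in> M" using eq d dec by auto
          then show False using u by (auto simp: N_def)
        qed
      qed
      then show "u @ v \<in> N" using u v sub by (auto simp: N_def submonoid_def)
    qed
    moreover have "u \<in> N" if "v \<in> N" "u @ v \<in> N" for u v
    proof -
      have uM: "u \<in> M" using M that by (auto simp: unitary_def N_def)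
      have "u \<noteq> y @ m" if "m \<in> M" for m
      proof
        assume "u = y @ m"
        then have "u @ v = y @ (m @ v)" "m @ v \<in> M"
          using sub that \<open>v \<in> N\<close> by (auto simp: submonoid_def N_def)
        then show False using \<open>u @ v \<in> N\<close> by (auto simp: N_def)
      qed
      then show ?thesis using uM by (auto simp: N_def)
    qed
    moreover have "Z \<subseteq> N"
    proof
      fix z assume "z \<in> Z"
      moreover have "z \<in> M" using \<open>z \<in> Z\<close> by (auto simp: M_def)
      ultimately show "z \<in> N" using no dec by (auto simp: N_def)
    qed
    ultimately have "M \<subseteq> N" unfolding M_def unitary_def by blast
    then have "y \<in> N" using yM by blast
    then show False using sub by (auto simp: N_def submonoid_def)
  qed
  have "Z \<subseteq> concat ` lists Y" unfolding dec[symmetric] by (auto simp: M_def)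
  then show thesis using that[of Y] nil inj first by blast
qed

section \<open>Monoids with a single branching residual\<close>

abbreviation prefixes_of :: "'a list set \<Rightarrow> 'a list set" where
  "prefixes_of S \<equiv> {p. \<exists>s. p @ s \<in> S}"

definition branching :: "'a list set \<Rightarrow> 'a list \<Rightarrow> bool" where
  "branching S p \<longleftrightarrow> (\<exists>c d. c \<noteq> d \<and> p @ [c] \<in> prefixes_of S \<and> p @ [d] \<in> prefixes_of S)"

lemma branching_parallel:
  assumes "u \<in> prefixes_of S" and "v \<in> prefixes_of S" and "\<not> prefix u v" and "\<not> prefix v u"
  obtains q c d u' v' where "branching S q" "c \<noteq> d" "u = q @ c # u'" "v = q @ d # v'"
proof -
  have "u \<parallel> v" using assms by (auto simp: parallel_def)
  then obtain q c d u' v' where *: "c \<noteq> d" "u = q @ c # u'" "v = q @ d # v'"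
    using parallel_decomp by blast
  then have "q @ [c] \<in> prefixes_of S" "q @ [d] \<in> prefixes_of S" using assms by auto
  then have "branching S q" using *(1) unfolding branching_def by blast
  then show thesis using that * by blast
qed

text \<open>Take the shortest continuation that ends in \<open>S\<close> or at a branching prefix.
  Before its end the tree of prefixes has a single path, so every word of \<open>S\<close> that goes
  this way follows it.\<close>

lemma next_stop:
  assumes "p @ [a] \<in> prefixes_of S"
  obtains t where "p @ a # t \<in> S \<or> branching S (p @ a # t)"
    "\<And>k. p @ a # k \<in> S \<Longrightarrow> prefix t k"
proof -
  define stop where "stop t \<longleftrightarrow> p @ a # t \<in> S \<or> branching S (p @ a # t)" for t
  obtain s where "p @ a # s \<in> S" using assms by auto
  then have "\<exists>t. stop t" by (auto simp: stop_def)
  then obtain t where t: "stop t" "\<And>t'. stop t' \<Longrightarrow> length t \<le> length t'"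
    using ex_has_least_nat[of stop _ length] by blast
  have "prefix t k" if k: "p @ a # k \<in> S" for k
  proof (rule ccontr)
    assume "\<not> prefix t k"
    moreover have "length t \<le> length k" using t(2)[of k] k by (simp add: stop_def)
    ultimately have "\<not> prefix k t" by (metis append_eq_conv_conj prefix_def take_all)
    have "p @ a # t \<in> prefixes_of S"
      using t(1) unfolding stop_def branching_def by auto (metis append_Nil2)
    moreover have "p @ a # k \<in> prefixes_of S"
      using k by (auto intro: exI[of _ "[]"])
    moreover obtain q c d t' k' where q: "c \<noteq> d" "t = q @ c # t'" "k = q @ d # k'"
      using parallel_decomp[of t k] \<open>\<not> prefix t k\<close> \<open>\<not> prefix k t\<close> by (auto simp: parallel_def)
    ultimately have "(p @ a # q) @ [c] \<in> prefixes_of S" "(p @ a # q) @ [d] \<in> prefixes_of S"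
      by auto
    \<comment> \<open>If \<open>k\<close> left the path of \<open>t\<close>, the point of departure
      would be an earlier stop.\<close>
    then have "stop q" using q(1) unfolding stop_def branching_def by blast
    then show False using t(2)[of q] q(2) by simp
  qed
  then show thesis using that t(1) by (simp add: stop_def)
qed

lemma gen_subset_by_descent:
  assumes "\<And>s. s \<in> S \<Longrightarrow> s \<noteq> [] \<Longrightarrow> \<exists>g v. g \<in> G \<and> g \<noteq> [] \<and> v \<in> S \<and> s = g @ v"
  shows "S \<subseteq> gen_monoid G"
proof
  fix s assume "s \<in> S"
  then show "s \<in> gen_monoid G"
  proof (induction s rule: length_induct)
    case (1 s)
    show ?case
    proof (cases "s = []")
      case True
      then show ?thesis by (simp add: gen_nil)
    next
      case False
      then obtain g v where "g \<in> G" "g \<noteq> []" "v \<in> S" "s = g @ v" using assms 1(2) by blast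
      then show ?thesis using 1(1) by (auto intro: gen_app)
    qed
  qed
qed

text \<open>All branching prefixes have the same residual \<open>K\<close>, so in the minimal
  automaton of \<open>S\<close> they are one state, with two outgoing letters. Elements of
  \<open>S\<close> have residual \<open>S\<close> by cancellation. Each of the two paths leaving the
  branching state next reaches \<open>S\<close> or the branching state again, and the cases below
  list the combinations.\<close>

lemma single_branching_residual:
  fixes S K :: "'a list set"
  assumes sub: "submonoid S" and cancel: "\<And>u v. u \<in> S \<Longrightarrow> u @ v \<in> S \<Longrightarrow> v \<in> S"
    and resid: "\<And>p k. branching S p \<Longrightarrow> p @ k \<in> S \<longleftrightarrow> k \<in> K"
    and letters: "\<And>p c d. p @ [c] \<in> prefixes_of S \<Longrightarrow> p @ [d] \<in> prefixes_of S \<Longrightarrow> c \<noteq> d \<Longrightarrow>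
      {c, d} = {a, b}"
  shows "(\<exists>\<alpha> \<beta>. S = gen_monoid {\<alpha>, \<beta>})
       \<or> (\<exists>\<alpha> \<beta> \<gamma>. \<alpha> \<noteq> [] \<and> \<beta> \<noteq> [] \<and> \<gamma> \<noteq> [] \<and>
            S = gen_monoid {\<alpha> @ word_pow \<gamma> i @ \<beta> | i. True})"
proof -
  have nil: "[] \<in> S" and app: "\<And>u v. u \<in> S \<Longrightarrow> v \<in> S \<Longrightarrow> u @ v \<in> S"
    using sub by (auto simp: submonoid_def)
  have cancel_iff: "u @ v \<in> S \<longleftrightarrow> v \<in> S" if "u \<in> S" for u v
    using that cancel app by blast
  consider (triv) "S \<subseteq> {[]}" | (chain) "\<not> S \<subseteq> {[]}" "\<And>p. \<not> branching S p"
    | (branch) "\<exists>p. branching S p"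
    by blast
  then show ?thesis
  proof cases
    case triv
    \<comment> \<open>The first alternative asks for two generators; degenerate cases repeat one,
      here the empty word.\<close>
    then have "S = gen_monoid {[], []}"
      using nil gen_least[OF sub, of "{[], []}"] gen_nil by blast
    then show ?thesis by blast
  next
    case chain
    then obtain e s where es: "e # s \<in> S" by (metis insertCI neq_Nil_conv subsetI)
    then have e: "[] @ [e] \<in> prefixes_of S" by auto
    \<comment> \<open>Without branching the next stop lies in \<open>S\<close>, and this one word
      generates everything.\<close>
    obtain t where t: "e # t \<in> S" "\<And>k. e # k \<in> S \<Longrightarrow> prefix t k"
      using next_stop[OF e] chain(2) by auto
    have "S \<subseteq> gen_monoid {e # t, e # t}"
    proof (rule gen_subset_by_descent)
      fix s assume s: "s \<in> S" "s \<noteq> []"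
      then obtain c s' where s': "s = c # s'" by (cases s) auto
      have "c = e"
      proof (rule ccontr)
        assume "c \<noteq> e"
        moreover have "[] @ [c] \<in> prefixes_of S" using s s' by auto
        ultimately show False using chain(2)[of "[]"] e unfolding branching_def by blast
      qed
      then have "prefix t s'" using t(2) s s' by blast
      then obtain v where "s = (e # t) @ v" using s' \<open>c = e\<close> by (auto simp: prefix_def)
      then show "\<exists>g v. g \<in> {e # t, e # t} \<and> g \<noteq> [] \<and> v \<in> S \<and> s = g @ v"
        using s t(1) cancel by blast
    qed
    moreover have "gen_monoid {e # t, e # t} \<subseteq> S"
      using t(1) by (intro gen_least[OF sub]) auto
    ultimately have "S = gen_monoid {e # t, e # t}" by (rule equalityI)
    then show ?thesis by blast
  next
    case branch
    then obtain \<alpha> where \<alpha>: "branching S \<alpha>"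
      and least: "\<And>p. branching S p \<Longrightarrow> length \<alpha> \<le> length p"
      using ex_has_least_nat[of "branching S" _ length] by blast
    obtain c d where cd: "c \<noteq> d" "\<alpha> @ [c] \<in> prefixes_of S" "\<alpha> @ [d] \<in> prefixes_of S"
      using \<alpha> unfolding branching_def by blast
    obtain t1 where t1: "\<alpha> @ c # t1 \<in> S \<or> branching S (\<alpha> @ c # t1)"
      "\<And>k. \<alpha> @ c # k \<in> S \<Longrightarrow> prefix t1 k"
      using next_stop[OF cd(2)] by blast
    obtain t2 where t2: "\<alpha> @ d # t2 \<in> S \<or> branching S (\<alpha> @ d # t2)"
      "\<And>k. \<alpha> @ d # k \<in> S \<Longrightarrow> prefix t2 k"
      using next_stop[OF cd(3)] by blast
    \<comment> \<open>The labels of the two paths from the branching state to the next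
      stops.\<close>
    define \<gamma> \<delta> where "\<gamma> = c # t1" and "\<delta> = d # t2"
    have ne: "\<gamma> \<noteq> []" "\<delta> \<noteq> []" by (simp_all add: \<gamma>_def \<delta>_def)
    have cover: "prefix \<gamma> k \<or> prefix \<delta> k" if k: "\<alpha> @ k \<in> S" "k \<noteq> []" for k
    proof -
      obtain f k' where k': "k = f # k'" using k by (cases k) auto
      then have f: "\<alpha> @ [f] \<in> prefixes_of S" using k by auto
      have "f = c \<or> f = d"
      \<comment> \<open>A third letter \<open>f\<close> would give
        \<open>{f, c} = {a, b} = {c, d}\<close>.\<close>
      proof (rule ccontr)
        assume "\<not> (f = c \<or> f = d)"
        then have "{f, c} = {c, d}"
          using letters[OF f cd(2)] letters[OF cd(2,3,1)] by simp
        then have "f \<in> {c, d}" by (metis insertI1)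
        then show False using \<open>\<not> (f = c \<or> f = d)\<close> by simp
      qed
      then show ?thesis using t1(2) t2(2) k k' by (auto simp: \<gamma>_def \<delta>_def)
    qed
    have stop: "\<alpha> @ \<gamma> \<in> S \<or> branching S (\<alpha> @ \<gamma>)" "\<alpha> @ \<delta> \<in> S \<or> branching S (\<alpha> @ \<delta>)"
      using t1 t2 by (simp_all add: \<gamma>_def \<delta>_def)
    show ?thesis
    proof (cases "\<alpha> \<in> S")
      case True
      \<comment> \<open>Here the branching state accepts, so every branching prefix is in
        \<open>S\<close>, and both stops are in \<open>S\<close> in either case.\<close>
      then have "[] \<in> K" using resid[OF \<alpha>, of "[]"] by simp
      then have "\<alpha> @ \<gamma> \<in> S" "\<alpha> @ \<delta> \<in> S"
        using stop resid[of "\<alpha> @ \<gamma>" "[]"] resid[of "\<alpha> @ \<delta>" "[]"] by auto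
      then have in_S: "\<gamma> \<in> S" "\<delta> \<in> S" using cancel True by blast+
      have "S \<subseteq> gen_monoid {\<gamma>, \<delta>}"
      proof (rule gen_subset_by_descent)
        fix s assume s: "s \<in> S" "s \<noteq> []"
        then have "prefix \<gamma> s \<or> prefix \<delta> s" using cover True app by blast
        then obtain g v where gv: "g \<in> {\<gamma>, \<delta>}" "s = g @ v" by (auto simp: prefix_def)
        then have "g \<in> S" "g \<noteq> []" using in_S ne by auto
        then show "\<exists>g v. g \<in> {\<gamma>, \<delta>} \<and> g \<noteq> [] \<and> v \<in> S \<and> s = g @ v"
          using gv s(1) cancel by blast
      qed
      moreover have "gen_monoid {\<gamma>, \<delta>} \<subseteq> S"
        using in_S by (intro gen_least[OF sub]) auto
      ultimately have "S = gen_monoid {\<gamma>, \<delta>}" by (rule equalityI)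
      then show ?thesis by blast
    next
      case False
      then have nilK: "[] \<notin> K" using resid[OF \<alpha>, of "[]"] by simp
      have coverK: "prefix \<gamma> k \<or> prefix \<delta> k" if "k \<in> K" for k
        using cover that resid[OF \<alpha>] nilK by metis
      \<comment> \<open>A proper prefix \<open>s\<close> of \<alpha> could be cancelled, leaving a
        shorter branching prefix; an \<open>s\<close> that leaves \<alpha> on the way would do so at
        a shorter branching prefix. Both contradict the choice of \<alpha>.\<close>
      have start: "\<exists>k\<in>K. s = \<alpha> @ k" if s: "s \<in> S" "s \<noteq> []" for s
      proof -
        have "prefix \<alpha> s"
        proof (rule ccontr)
          assume no: "\<not> prefix \<alpha> s"
          show False
          proof (cases "prefix s \<alpha>")
            case True
            then obtain \<alpha>' where \<alpha>': "\<alpha> = s @ \<alpha>'" by (auto simp: prefix_def)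
            have "\<alpha>' @ [c] \<in> prefixes_of S" "\<alpha>' @ [d] \<in> prefixes_of S"
              using cd(2,3) cancel[OF s(1)] \<alpha>' by auto
            then have "branching S \<alpha>'" using cd(1) unfolding branching_def by blast
            then show False using least[of \<alpha>'] \<alpha>' s by simp
          next
            case False
            have pre: "\<alpha> \<in> prefixes_of S" "s \<in> prefixes_of S"
              using cd(2) s by (auto intro: exI[of _ "[]"])
            obtain q e f u' v' where "branching S q" "e \<noteq> f" "\<alpha> = q @ e # u'" "s = q @ f # v'"
              by (rule branching_parallel[OF pre no False])
            then show False using least[of q] by simp
          qed
        qed
        then show ?thesis using s resid[OF \<alpha>] by (auto simp: prefix_def)
      qed
      have \<alpha>K: "\<alpha> @ k \<in> S \<longleftrightarrow> k \<in> K" for k by (rule resid[OF \<alpha>])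
      \<comment> \<open>The transitions of the automaton: \<open>stepK\<close> returns to the
        branching state, \<open>exitK\<close> to the initial state.\<close>
      have stepK: "g @ k \<in> K \<longleftrightarrow> k \<in> K" if "branching S (\<alpha> @ g)" for g k
        using resid[OF that, of k] \<alpha>K[of "g @ k"] by simp
      have exitK: "g @ k \<in> K \<longleftrightarrow> k \<in> S" if "\<alpha> @ g \<in> S" for g k
        using cancel_iff[OF that, of k] \<alpha>K[of "g @ k"] by simp
      \<comment> \<open>With \<open>g\<close> looping at the branching state and \<open>h\<close>
        leaving it, a word of \<open>K\<close> is some power of \<open>g\<close>, then
        \<open>h\<close>, then an element of \<open>S\<close>.\<close>
      have loop: "S = gen_monoid {\<alpha> @ word_pow g i @ h | i. True}"
        if g: "branching S (\<alpha> @ g)" "g \<noteq> []" and h: "\<alpha> @ h \<in> S"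
          and gh: "\<And>k. k \<in> K \<Longrightarrow> prefix g k \<or> prefix h k" for g h
      proof -
        have dec: "\<exists>i s. s \<in> S \<and> k = word_pow g i @ h @ s" if "k \<in> K" for k
          using that
        proof (induction k rule: length_induct)
          case (1 k)
          note IH = 1(1)
          consider k' where "k = g @ k'" | s where "k = h @ s"
            using gh[OF 1(2)] unfolding prefix_def by blast
          then show ?case
          proof cases
            case 1
            then have "k' \<in> K" "length k' < length k" using \<open>k \<in> K\<close> stepK[OF g(1)] g(2) by auto
            then obtain i s where "s \<in> S" "k' = word_pow g i @ h @ s"
              using IH by blast
            then have "s \<in> S \<and> k = word_pow g (Suc i) @ h @ s"
              using 1 by (simp add: word_pow_def)
            then show ?thesis by blast
          next
            case 2
            then have "s \<in> S \<and> k = word_pow g 0 @ h @ s"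
              using \<open>k \<in> K\<close> exitK[OF h] by (simp add: word_pow_def)
            then show ?thesis by blast
          qed
        qed
        have "S \<subseteq> gen_monoid {\<alpha> @ word_pow g i @ h | i. True}"
        proof (rule gen_subset_by_descent)
          fix s assume "s \<in> S" "s \<noteq> []"
          then obtain k where "k \<in> K" "s = \<alpha> @ k" using start by blast
          then obtain i v where "v \<in> S" "s = (\<alpha> @ word_pow g i @ h) @ v" using dec by fastforce
          then show "\<exists>f v. f \<in> {\<alpha> @ word_pow g i @ h | i. True} \<and> f \<noteq> [] \<and> v \<in> S \<and> s = f @ v"
            using False nil by (intro exI[of _ "\<alpha> @ word_pow g i @ h"] exI[of _ v]) auto
        qed
        moreover have "word_pow g i @ h \<in> K" for i
        proof (induction i)
          case 0
          show ?case using h \<alpha>K by (simp add: word_pow_def)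
        next
          case (Suc i)
          then show ?case using stepK[OF g(1)] by (simp add: word_pow_def)
        qed
        then have "gen_monoid {\<alpha> @ word_pow g i @ h | i. True} \<subseteq> S"
          using \<alpha>K by (intro gen_least[OF sub]) auto
        ultimately show ?thesis by (rule equalityI)
      qed
      have "\<alpha> \<noteq> []" using False nil by blast
      consider "\<alpha> @ \<gamma> \<in> S" "\<alpha> @ \<delta> \<in> S" | "branching S (\<alpha> @ \<gamma>)" "\<alpha> @ \<delta> \<in> S"
        | "branching S (\<alpha> @ \<delta>)" "\<alpha> @ \<gamma> \<in> S" | "branching S (\<alpha> @ \<gamma>)" "branching S (\<alpha> @ \<delta>)"
        using stop by blast
      then show ?thesis
      proof cases
        case 1
        have "S \<subseteq> gen_monoid {\<alpha> @ \<gamma>, \<alpha> @ \<delta>}"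
        proof (rule gen_subset_by_descent)
          fix s assume s: "s \<in> S" "s \<noteq> []"
          then obtain k where k: "k \<in> K" "s = \<alpha> @ k" using start by blast
          obtain h v where "h \<in> {\<gamma>, \<delta>}" "k = h @ v"
            using coverK[OF k(1)] by (auto simp: prefix_def)
          then obtain g where gv: "g \<in> {\<alpha> @ \<gamma>, \<alpha> @ \<delta>}" "s = g @ v"
            using k(2) by auto
          then have "g \<in> S" "g \<noteq> []" using 1 ne by auto
          then show "\<exists>g v. g \<in> {\<alpha> @ \<gamma>, \<alpha> @ \<delta>} \<and> g \<noteq> [] \<and> v \<in> S \<and> s = g @ v"
            using gv s(1) cancel by blast
        qed
        moreover have "gen_monoid {\<alpha> @ \<gamma>, \<alpha> @ \<delta>} \<subseteq> S"
          using 1 by (intro gen_least[OF sub]) auto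
        ultimately have "S = gen_monoid {\<alpha> @ \<gamma>, \<alpha> @ \<delta>}" by (rule equalityI)
        then show ?thesis by blast
      next
        case 2
        then have "S = gen_monoid {\<alpha> @ word_pow \<gamma> i @ \<delta> | i. True}"
          using ne coverK by (intro loop) auto
        then show ?thesis using \<open>\<alpha> \<noteq> []\<close> ne by blast
      next
        case 3
        then have "S = gen_monoid {\<alpha> @ word_pow \<delta> i @ \<gamma> | i. True}"
          using ne coverK by (intro loop) auto
        then show ?thesis using \<open>\<alpha> \<noteq> []\<close> ne by blast
      next
        case 4
        \<comment> \<open>If both paths loop, each word of \<open>K\<close> has a shorter one as
          remainder, so \<open>K\<close> would be empty.\<close>
        have "k \<notin> K" for k
        proof (induction k rule: length_induct)
          case (1 k)
          show ?case
          proof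
            assume k: "k \<in> K"
            then obtain k' where "k = \<gamma> @ k' \<or> k = \<delta> @ k'"
              using coverK by (auto simp: prefix_def)
            then have "k' \<in> K" "length k' < length k"
              using k 4 ne stepK by auto
            then show False using 1 by blast
          qed
        qed
        moreover obtain r where "c # r \<in> K" using cd(2) \<alpha>K by auto
        ultimately show ?thesis by blast
      qed
    qed
  qed
qed

section \<open>Branching in a product of prefix trees\<close>

lemma prefix_snoc_nth:
  assumes "prefix (q @ [c]) x"
  shows "length q < length x" "x ! length q = c" "\<And>i. i < length q \<Longrightarrow> x ! i = q ! i"
  using assms by (auto simp: prefix_def nth_append)

text \<open>Two words can part only at the end of their longest common prefix.\<close>

lemma branching_node_unique:
  assumes "prefix (q @ [c]) x" "prefix (q @ [d]) y" "c \<noteq> d"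
    and "prefix (q' @ [c']) x" "prefix (q' @ [d']) y" "c' \<noteq> d'"
  shows "q = q' \<and> c = c' \<and> d = d'"
proof -
  note n = assms(1,2,4,5)[THEN prefix_snoc_nth(1)] assms(1,2,4,5)[THEN prefix_snoc_nth(2)]
  have "\<not> length q < length q'"
    using n assms(3,4,5) prefix_snoc_nth(3) by metis
  moreover have "\<not> length q' < length q"
    using n assms(1,2,6) prefix_snoc_nth(3) by metis
  ultimately have "length q = length q'" by simp
  then have "q = q'"
    using assms(1,4) by (auto simp: prefix_def)
  then show ?thesis using n by auto
qed

lemma hd_prefix_snoc:
  assumes "prefix (q @ [c]) x"
  shows "hd x = (if q = [] then c else hd q)"
  using assms by (auto simp: prefix_def)

lemma branching_letters_unique:
  assumes U: "finite U" "card U \<le> 3" and A: "card A = 3" "card (A \<union> hd ` U) \<ge> 4"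
    and meet: "A \<inter> hd ` U \<noteq> {}"
    and 1: "x \<in> U" "y \<in> U" "prefix (q @ [c]) x" "prefix (q @ [d]) y" "c \<noteq> d" "c \<in> A" "d \<in> A"
    and 2: "x' \<in> U" "y' \<in> U" "prefix (q' @ [c']) x'" "prefix (q' @ [d']) y'" "c' \<noteq> d'"
      "c' \<in> A" "d' \<in> A"
  shows "q' = q \<and> {c', d'} = {c, d}"
proof -
  have finA: "finite A" using A(1) by (simp add: card_ge_0_finite)
  have cardUn: "card (A \<union> hd ` U) + card (A \<inter> hd ` U) = 3 + card (hd ` U)"
    using card_Un_Int[OF finA, of "hd ` U"] U(1) A(1) by simp
  have le: "card (hd ` U) \<le> card U" using U(1) by (rule card_image_le)
  have root: "inj_on hd U \<and> {c, d} = A \<inter> hd ` U"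
    if "x \<in> U" "y \<in> U" "prefix ([] @ [c]) x" "prefix ([] @ [d]) y" "c \<noteq> d" "c \<in> A" "d \<in> A"
    for x y c d
  proof -
    have "hd x = c" "hd y = d" using hd_prefix_snoc[OF that(3)] hd_prefix_snoc[OF that(4)] by auto
    then have sub: "{c, d} \<subseteq> A \<inter> hd ` U" using that by auto
    have fin: "finite (A \<inter> hd ` U)" using finA by simp
    have "2 \<le> card (A \<inter> hd ` U)" using card_mono[OF fin sub] that(5) by simp
    then have "card (hd ` U) = card U" "card (A \<inter> hd ` U) = 2"
      using cardUn le U A by linarith+
    then show ?thesis
      using eq_card_imp_inj_on[OF U(1)] card_subset_eq[OF fin sub] that(5) by simp
  qed
  have inner: "\<not> inj_on hd U \<and> hd x = hd y \<and> x \<noteq> y"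
    if "x \<in> U" "y \<in> U" "prefix (q @ [c]) x" "prefix (q @ [d]) y" "c \<noteq> d" "q \<noteq> []"
    for x y and q :: "'a list" and c d
  proof -
    have "hd x = hd y" using hd_prefix_snoc[OF that(3)] hd_prefix_snoc[OF that(4)] that(6) by simp
    moreover have "x \<noteq> y" using prefix_snoc_nth(2) that(3,4,5) by metis
    ultimately show ?thesis using that(1,2) by (auto simp: inj_on_def)
  qed
  show ?thesis
  proof (cases "q = []")
    case True
    then have *: "inj_on hd U \<and> {c, d} = A \<inter> hd ` U" using root[of x y c d] 1 by blast
    then have "q' = []" using inner[of x' y' q' c' d'] 2 by blast
    then show ?thesis using * root[of x' y' c' d'] 2 True by simp
  next
    case False
    then have *: "\<not> inj_on hd U" "hd x = hd y" "x \<noteq> y" using inner[of x y q c d] 1 by blast+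
    then have "q' \<noteq> []" using root[of x' y' c' d'] 2 by blast
    then have **: "hd x' = hd y'" "x' \<noteq> y'" using inner[of x' y' q' c' d'] 2 by blast+
    have "card (A \<inter> hd ` U) \<noteq> 0" using meet finA by simp
    then have two: "2 \<le> card (hd ` U)" using cardUn A by linarith
    \<comment> \<open>Two different pairs would cover the three words of \<open>U\<close> and
      overlap, so all first letters would agree, contrary to \<open>two\<close>.\<close>
    have "{x', y'} = {x, y}"
    proof (rule ccontr)
      assume neq: "{x', y'} \<noteq> {x, y}"
      have xy: "{x, y} \<subseteq> U" "card {x, y} = 2" "{x', y'} \<subseteq> U" "card {x', y'} = 2"
        using 1 2 * ** by auto
      have "{x, y} \<union> {x', y'} \<noteq> {x, y}"
        using neq card_subset_eq[of "{x, y}" "{x', y'}"] xy by auto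
      then have "card {x, y} < card ({x, y} \<union> {x', y'})"
        by (intro psubset_card_mono) auto
      moreover have "card ({x, y} \<union> {x', y'}) \<le> card U"
        using xy by (intro card_mono[OF U(1)]) auto
      ultimately have c3: "card ({x, y} \<union> {x', y'}) = 3" and "card U = 3"
        using xy U(2) by linarith+
      then have UE: "{x, y} \<union> {x', y'} = U"
        using card_subset_eq[OF U(1), of "{x, y} \<union> {x', y'}"] xy by auto
      have "card ({x, y} \<inter> {x', y'}) = 1"
        using card_Un_Int[of "{x, y}" "{x', y'}"] xy c3 by simp
      then have "{x, y} \<inter> {x', y'} \<noteq> {}" by (metis card.empty zero_neq_one)
      then have "hd x' = hd x" using * ** by auto
      then have "hd ` U \<subseteq> {hd x}" using * ** unfolding UE[symmetric] by auto
      then show False using card_mono[of "{hd x}" "hd ` U"] two by simp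
    qed
    then have "x' = x \<and> y' = y \<or> x' = y \<and> y' = x" by (auto simp: doubleton_eq_iff)
    then show ?thesis
    proof
      assume "x' = x \<and> y' = y"
      then show ?thesis using branching_node_unique[OF 1(3,4,5), of q' c' d'] 2 by simp
    next
      assume "x' = y \<and> y' = x"
      then show ?thesis using branching_node_unique[OF 1(3,4,5), of q' d' c'] 2 by auto
    qed
  qed
qed

text \<open>Distinct first letters make the tree of \<open>X\<close> branch at its root only. A
  branching prefix of the intersection therefore lies in \<open>gen_monoid X\<close>, and its
  position in the tree of \<open>U\<close> is the one node left by the counting argument. This pair
  of positions is the single branching state.\<close>

lemma intersection_inj_hd:
  fixes X U :: "'a list set"
  assumes codes: "prefix_code X" "prefix_code U"
    and U: "finite U" "card U \<le> 3"
    and inj: "inj_on hd X" and A: "card (hd ` X) = 3" "card (hd ` X \<union> hd ` U) \<ge> 4"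
    and meet: "hd ` X \<inter> hd ` U \<noteq> {}"
  shows "(\<exists>\<alpha> \<beta>. gen_monoid X \<inter> gen_monoid U = gen_monoid {\<alpha>, \<beta>})
       \<or> (\<exists>\<alpha> \<beta> \<gamma>. \<alpha> \<noteq> [] \<and> \<beta> \<noteq> [] \<and> \<gamma> \<noteq> [] \<and>
            gen_monoid X \<inter> gen_monoid U = gen_monoid {\<alpha> @ word_pow \<gamma> i @ \<beta> | i. True})"
proof -
  define S where "S = gen_monoid X \<inter> gen_monoid U"
  \<comment> \<open>Nodes of the tree of \<open>U\<close> that can branch together with the root of
    the tree of \<open>X\<close>.\<close>
  define node where "node q c d \<longleftrightarrow> (\<exists>x y. x \<in> U \<and> y \<in> U \<and> prefix (q @ [c]) x \<and>
    prefix (q @ [d]) y \<and> c \<noteq> d \<and> c \<in> hd ` X \<and> d \<in> hd ` X)" for q c d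
  have sub: "submonoid S"
    using submonoid_gen[of X] submonoid_gen[of U] by (auto simp: S_def submonoid_def)
  have cancel: "v \<in> S" if "u \<in> S" "u @ v \<in> S" for u v
    using that codes prefix_code_cancel by (auto simp: S_def)
  have at_node: "p \<in> gen_monoid X \<and> (\<exists>u q. p = u @ q \<and> u \<in> gen_monoid U \<and> node q c d)"
    if p: "p @ [c] \<in> prefixes_of S" "p @ [d] \<in> prefixes_of S" "c \<noteq> d" for p c d
  proof -
    obtain s t where st: "p @ c # s \<in> gen_monoid X" "p @ d # t \<in> gen_monoid X"
      "p @ c # s \<in> gen_monoid U" "p @ d # t \<in> gen_monoid U"
      using p by (auto simp: S_def)
    obtain u q x y where X: "p = u @ q" "u \<in> gen_monoid X" "x \<in> X" "y \<in> X"
      "prefix (q @ [c]) x" "prefix (q @ [d]) y"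
      using gen_branch[OF codes(1) st(1,2)] by blast
    obtain u' q' x' y' where U': "p = u' @ q'" "u' \<in> gen_monoid U" "x' \<in> U" "y' \<in> U"
      "prefix (q' @ [c]) x'" "prefix (q' @ [d]) y'"
      using gen_branch[OF codes(2) st(3,4)] by blast
    \<comment> \<open>Below the root, \<open>x\<close> and \<open>y\<close> would share their first
      letter and so coincide, although they part after \<open>q\<close>.\<close>
    have "q = []"
    proof (rule ccontr)
      assume "q \<noteq> []"
      then have "hd x = hd y" using hd_prefix_snoc[OF X(5)] hd_prefix_snoc[OF X(6)] by simp
      then have "x = y" using inj X by (simp add: inj_on_def)
      then show False using prefix_snoc_nth(2) X p(3) by metis
    qed
    then have "hd x = c" "hd y = d"
      using hd_prefix_snoc[OF X(5)] hd_prefix_snoc[OF X(6)] by simp_all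
    then have "c \<in> hd ` X" "d \<in> hd ` X" using X by auto
    then show ?thesis using U' X \<open>q = []\<close> p(3) unfolding node_def by auto
  qed
  have unique: "q' = q \<and> {c', d'} = {c, d}" if "node q c d" "node q' c' d'" for q c d q' c' d'
    using that branching_letters_unique[OF U A meet] unfolding node_def by meson
  have "\<exists>K a b. (\<forall>p k. branching S p \<longrightarrow> (p @ k \<in> S \<longleftrightarrow> k \<in> K)) \<and>
    (\<forall>p c d. p @ [c] \<in> prefixes_of S \<longrightarrow> p @ [d] \<in> prefixes_of S \<longrightarrow> c \<noteq> d \<longrightarrow> {c, d} = {a, b})"
  proof (cases "\<exists>p. branching S p")
    case False
    then show ?thesis unfolding branching_def by blast
  next
    case True
    then obtain q a b where q: "node q a b" using at_node unfolding branching_def by blast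
    \<comment> \<open>The continuations accepted from the root of the tree of \<open>X\<close>
      together with node \<open>q\<close> of the tree of \<open>U\<close>.\<close>
    define K where "K = {k \<in> gen_monoid X. q @ k \<in> gen_monoid U}"
    have "p @ k \<in> S \<longleftrightarrow> k \<in> K" if "branching S p" for p k
    proof -
      obtain c d where "c \<noteq> d" "p @ [c] \<in> prefixes_of S" "p @ [d] \<in> prefixes_of S"
        using \<open>branching S p\<close> unfolding branching_def by blast
      then obtain u q' where "p \<in> gen_monoid X" "p = u @ q'" "u \<in> gen_monoid U" "node q' c d"
        using at_node by meson
      then have "p \<in> gen_monoid X" "p = u @ q" "u \<in> gen_monoid U" using unique[OF q] by blast+
      then show ?thesis
        using prefix_code_cancel[OF codes(1), of p k] prefix_code_cancel[OF codes(2), of u "q @ k"]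
        by (simp add: S_def K_def)
    qed
    moreover have "{c, d} = {a, b}"
      if "p @ [c] \<in> prefixes_of S" "p @ [d] \<in> prefixes_of S" "c \<noteq> d" for p c d
      using at_node[OF that] unique[OF q] by blast
    ultimately show ?thesis by blast
  qed
  then obtain K a b where
    resid: "\<forall>p k. branching S p \<longrightarrow> (p @ k \<in> S \<longleftrightarrow> k \<in> K)" and
    letters: "\<forall>p c d. p @ [c] \<in> prefixes_of S \<longrightarrow> p @ [d] \<in> prefixes_of S \<longrightarrow> c \<noteq> d \<longrightarrow>
      {c, d} = {a, b}"
    by (elim exE conjE)
  show ?thesis
    unfolding S_def[symmetric]
    by (rule single_branching_residual[OF sub cancel resid[rule_format] letters[rule_format]])
qed

section \<open>Intersections of prefix codes with at least four first letters\<close>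

lemma intersection_of_prefix_codes:
  fixes X U :: "'a list set"
  assumes codes: "prefix_code X" "prefix_code U"
    and X: "finite X" "card X \<le> 3" and U: "finite U" "card U \<le> 3"
    and heads: "card (hd ` X \<union> hd ` U) \<ge> 4"
  shows "(\<exists>\<alpha> \<beta>. gen_monoid X \<inter> gen_monoid U = gen_monoid {\<alpha>, \<beta>})
       \<or> (\<exists>\<alpha> \<beta> \<gamma>. \<alpha> \<noteq> [] \<and> \<beta> \<noteq> [] \<and> \<gamma> \<noteq> [] \<and>
            gen_monoid X \<inter> gen_monoid U = gen_monoid {\<alpha> @ word_pow \<gamma> i @ \<beta> | i. True})"
proof (cases "hd ` X \<inter> hd ` U = {}")
  case True
  have "w = []" if w: "w \<in> gen_monoid X" "w \<in> gen_monoid U" for w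
  proof (rule ccontr)
    assume "w \<noteq> []"
    obtain x v where x: "x \<in> X" "w = x @ v" by (rule gen_cases[OF w(1) \<open>w \<noteq> []\<close>])
    obtain u t where u: "u \<in> U" "w = u @ t" by (rule gen_cases[OF w(2) \<open>w \<noteq> []\<close>])
    have "x \<noteq> []" "u \<noteq> []" using x u codes by (auto simp: prefix_code_def)
    then have "hd w = hd x" "hd w = hd u" using x u by (metis hd_append2)+
    then have "hd w \<in> hd ` X \<inter> hd ` U" using x(1) u(1) by (metis IntI image_eqI)
    then show False using True by simp
  qed
  moreover have "w = []" if "w \<in> gen_monoid {[], []}" for w :: "'a list"
    using that by induction auto
  \<comment> \<open>Without a common first letter only the empty word is common.\<close>
  ultimately have "gen_monoid X \<inter> gen_monoid U = gen_monoid {[], []}"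
    using gen_nil by blast
  then show ?thesis by blast
next
  case False
  have le: "card (hd ` X) \<le> card X" "card (hd ` U) \<le> card U"
    using X U by (simp_all add: card_image_le)
  have "card (hd ` X \<inter> hd ` U) \<noteq> 0" using False X by simp
  \<comment> \<open>The union has at least four elements and the intersection at least one, so the
    two sets of first letters have sizes summing to at least five; one of them has size
    three.\<close>
  then have "card (hd ` X) = 3 \<and> card X = 3 \<or> card (hd ` U) = 3 \<and> card U = 3"
    using card_Un_Int[of "hd ` X" "hd ` U"] heads le X U
    by (simp del: card_0_eq card_eq_0_iff) linarith
  then show ?thesis
  proof
    assume *: "card (hd ` X) = 3 \<and> card X = 3"
    then have "inj_on hd X" using eq_card_imp_inj_on[OF X(1)] by metis
    then show ?thesis
      by (rule intersection_inj_hd[OF codes U _ conjunct1[OF *] heads False])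
  next
    assume *: "card (hd ` U) = 3 \<and> card U = 3"
    then have "inj_on hd U" using eq_card_imp_inj_on[OF U(1)] by metis
    moreover have "card (hd ` U \<union> hd ` X) \<ge> 4" "hd ` U \<inter> hd ` X \<noteq> {}"
      using heads False by (simp_all add: Un_commute Int_commute)
    ultimately show ?thesis
      unfolding Int_commute[of "gen_monoid X"]
      by (intro intersection_inj_hd[OF codes(2,1) X _ conjunct1[OF *]])
  qed
qed

section \<open>Passage to the hull alphabet and back\<close>

lemma word_pow_concat: "concat (word_pow w i) = word_pow (concat w) i"
  by (induction i) (simp_all add: word_pow_def)

theorem mainTheorem9:
  fixes X U :: "('a::countable) list set"
  assumes "card X = 3" and "[] \<notin> X"
    and "card U = 3" and "[] \<notin> U"
    and "k_maximal 3 (gen_monoid X)" and "k_maximal 3 (gen_monoid U)"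
    and "gen_monoid X \<noteq> gen_monoid U"
  shows "(\<exists>\<alpha> \<beta>. gen_monoid X \<inter> gen_monoid U = gen_monoid {\<alpha>, \<beta>})
       \<or> (\<exists>\<alpha> \<beta> \<gamma>. \<alpha> \<noteq> [] \<and> \<beta> \<noteq> [] \<and> \<gamma> \<noteq> [] \<and>
            gen_monoid X \<inter> gen_monoid U = gen_monoid {\<alpha> @ word_pow \<gamma> i @ \<beta> | i. True})"
proof -
  let ?M = "gen_monoid X" and ?N = "gen_monoid U"
  have finX: "finite X" "finite U" using assms(1,3) by (simp_all add: card_ge_0_finite)
  have fin: "finite (basis ?M)" "card (basis ?M) \<le> 3" "finite (basis ?N)" "card (basis ?N) \<le> 3"
    using finX basis_gen_subset[of X] basis_gen_subset[of U] assms(1,3)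
      card_mono[OF finX(1)] card_mono[OF finX(2)]
    by (auto intro: finite_subset)
  have gens: "gen_monoid (basis ?M) = ?M" "gen_monoid (basis ?N) = ?N"
    by (simp_all add: gen_basis submonoid_gen)
  have codes: "prefix_code (basis ?M)" "prefix_code (basis ?N)"
    using assms(5,6) by (auto intro: k_maximal_basis_prefix_code)
  obtain Y where Y: "[] \<notin> Y" "inj_on concat (lists Y)" "basis ?M \<union> basis ?N \<subseteq> concat ` lists Y"
    "\<And>y. y \<in> Y \<Longrightarrow> \<exists>zs \<in> lists Y. concat (y # zs) \<in> basis ?M \<union> basis ?N"
    using suffix_hull[of "basis ?M \<union> basis ?N"] by blast
  \<comment> \<open>\<open>D Z\<close> rewrites the words of \<open>Z\<close> over the alphabet
    \<open>Y\<close>; unique factorization makes this a bijection when \<open>Z\<close> lies in the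
    hull.\<close>
  define D where "D Z = {zs \<in> lists Y. concat zs \<in> Z}" for Z
  have imD: "concat ` D Z = Z" if "Z \<subseteq> concat ` lists Y" for Z
    using that by (auto simp: D_def)
  have injD: "inj_on concat (D Z)" for Z
    using Y(2) by (rule inj_on_subset) (auto simp: D_def)
  have codeD: "prefix_code (D Z)" if "prefix_code Z" for Z
    unfolding prefix_code_def
  proof (intro conjI ballI impI)
    show "[] \<notin> D Z" using that by (auto simp: D_def prefix_code_def)
    fix xs ys assume xs: "xs \<in> D Z" "ys \<in> D Z" "prefix xs ys"
    then have "prefix (concat xs) (concat ys)" by (auto simp: prefix_def)
    then have "concat xs = concat ys" using that xs by (auto simp: D_def prefix_code_def)
    then show "xs = ys" using injD[of Z] xs by (simp add: inj_on_def)
  qed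
  have finD: "finite (D Z)" "card (D Z) = card Z" if "Z \<subseteq> concat ` lists Y" "finite Z" for Z
    using imD[OF that(1)] injD[of Z] that(2) by (metis finite_imageD, metis card_image)
  define X' U' where "X' = D (basis ?M)" and "U' = D (basis ?N)"
  have YX: "basis ?M \<subseteq> concat ` lists Y" "basis ?N \<subseteq> concat ` lists Y" using Y(3) by auto
  have im: "concat ` gen_monoid X' = ?M" "concat ` gen_monoid U' = ?N"
    using gen_image_concat[of X'] gen_image_concat[of U'] imD[OF YX(1)] imD[OF YX(2)] gens
    by (simp_all add: X'_def U'_def)
  have code': "prefix_code X'" "prefix_code U'"
    using codes codeD by (simp_all add: X'_def U'_def)
  have fin': "finite X'" "card X' \<le> 3" "finite U'" "card U' \<le> 3"
    using finD YX fin by (simp_all add: X'_def U'_def)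
  have lists: "gen_monoid X' \<subseteq> lists Y" "gen_monoid U' \<subseteq> lists Y"
    by (rule gen_least; auto simp: submonoid_def X'_def U'_def D_def)+
  have heads: "hd ` X' \<union> hd ` U' = Y"
  proof
    have "hd zs \<in> Y" if "zs \<in> X' \<union> U'" for zs
    proof -
      have "zs \<noteq> []" "zs \<in> lists Y"
        using that code' by (auto simp: X'_def U'_def D_def prefix_code_def)
      then show ?thesis by (cases zs) auto
    qed
    then show "hd ` X' \<union> hd ` U' \<subseteq> Y" by auto
    show "Y \<subseteq> hd ` X' \<union> hd ` U'"
    proof
      fix y assume y: "y \<in> Y"
      then obtain zs where "zs \<in> lists Y" "concat (y # zs) \<in> basis ?M \<union> basis ?N" using Y(4) by blast
      then have "y # zs \<in> X' \<union> U'" using y by (auto simp: X'_def U'_def D_def)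
      then show "y \<in> hd ` X' \<union> hd ` U'" by force
    qed
  qed
  \<comment> \<open>With at most three letters the hull would have rank at most three and contain
    both monoids, so maximality would make both equal to it.\<close>
  have "card Y \<ge> 4"
  proof (rule ccontr)
    assume "\<not> card Y \<ge> 4"
    moreover have "finite Y" using heads fin' by (metis finite_UnI finite_imageI)
    ultimately have "rank (gen_monoid Y) \<le> enat 3" by (intro rank_gen_le) auto
    moreover have "?M \<subseteq> gen_monoid Y" "?N \<subseteq> gen_monoid Y"
      using im lists by (metis gen_eq_concat_lists image_mono)+
    ultimately have "?M = gen_monoid Y" "?N = gen_monoid Y"
      using assms(5,6) submonoid_gen[of Y] by (auto simp: k_maximal_def)
    then show False using assms(7) by simp
  qed
  then have result: "(\<exists>\<alpha> \<beta>. gen_monoid X' \<inter> gen_monoid U' = gen_monoid {\<alpha>, \<beta>})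
       \<or> (\<exists>\<alpha> \<beta> \<gamma>. \<alpha> \<noteq> [] \<and> \<beta> \<noteq> [] \<and> \<gamma> \<noteq> [] \<and>
            gen_monoid X' \<inter> gen_monoid U' = gen_monoid {\<alpha> @ word_pow \<gamma> i @ \<beta> | i. True})"
    using intersection_of_prefix_codes[OF code' fin'] heads by simp
  \<comment> \<open>Images commute with this intersection because \<open>concat\<close> is injective
    on \<open>lists Y\<close>.\<close>
  have int: "?M \<inter> ?N = concat ` (gen_monoid X' \<inter> gen_monoid U')"
    using inj_on_image_Int[OF Y(2) lists] im by simp
  from result show ?thesis
  proof (elim disjE exE conjE)
    fix \<alpha> \<beta> assume "gen_monoid X' \<inter> gen_monoid U' = gen_monoid {\<alpha>, \<beta>}"
    then have "?M \<inter> ?N = gen_monoid {concat \<alpha>, concat \<beta>}"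
      using int gen_image_concat[of "{\<alpha>, \<beta>}"] by simp
    then show ?thesis by blast
  next
    fix \<alpha> \<beta> \<gamma> assume ne: "\<alpha> \<noteq> []" "\<beta> \<noteq> []" "\<gamma> \<noteq> []"
      and eq: "gen_monoid X' \<inter> gen_monoid U' = gen_monoid {\<alpha> @ word_pow \<gamma> i @ \<beta> | i. True}"
    have "concat ` {\<alpha> @ word_pow \<gamma> i @ \<beta> | i. True} =
        {concat \<alpha> @ word_pow (concat \<gamma>) i @ concat \<beta> | i. True}"
      by (auto simp: image_def) (metis concat_append word_pow_concat)+
    then have image: "?M \<inter> ?N = gen_monoid {concat \<alpha> @ word_pow (concat \<gamma>) i @ concat \<beta> | i. True}"
      using int eq gen_image_concat by metis
    \<comment> \<open>Exponent 1 makes \<gamma> occur, so that all three words are seen to be over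
      \<open>Y\<close>. As \<open>Y\<close> omits the empty word, they stay nonempty when spelled
      out.\<close>
    have "\<alpha> @ word_pow \<gamma> 1 @ \<beta> \<in> gen_monoid X' \<inter> gen_monoid U'"
      unfolding eq by (rule gen_base) blast
    then have "\<alpha> @ word_pow \<gamma> 1 @ \<beta> \<in> lists Y" using lists(1) by (meson IntD1 subsetD)
    then have "\<alpha> \<in> lists Y" "\<beta> \<in> lists Y" "\<gamma> \<in> lists Y" by (simp_all add: word_pow_def)
    moreover have "concat zs \<noteq> []" if "zs \<noteq> []" "zs \<in> lists Y" for zs
      using that Y(1) by (cases zs) auto
    ultimately have "concat \<alpha> \<noteq> []" "concat \<beta> \<noteq> []" "concat \<gamma> \<noteq> []"
      using ne by blast+
    then show ?thesis using image by blast
  qed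
qed

end
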